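(* Let $p$ be a prime and let $G$ be a finite group acting transitively on a finite set $\Omega$ with system of imprimitivity $\mathcal{B}$. Let $B\in\mathcal{B}$, let $G_B^B$ be the permutation group induced on $B$ by the setwise stabiliser $G_B$, and let $G^{\mathcal{B}}$ be the permutation group induced by $G$ on $\mathcal{B}$. (1) If $G_B^B$ (acting on $B$) and $G^{\mathcal{B}}$ (acting on $\mathcal{B}$) have Property $( * )_p$, then $G$ (acting on $\Omega$) has Property $( * )_p$. (2) If $G$ has Property $( * )_p$ then $G_B^B$ has Property $( * )_p$. (3) If $G$ has Property $( * )_p$ then $G^{\mathcal{B}}$ does not necessarily have Property $( * )_p$; that is, there exist a prime $p$, a finite group $G$ acting transitively on a finite set $\Omega$ with Property $( * )_p$, and a system of imprimitivity $\mathcal{B}$ for $G$ on $\Omega$, such that $G^{\mathcal{B}}$ acting on $\mathcal{B}$ does not have Property $( * )_p$.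
   Context: A finite group $G$ acting on a finite set $\Omega$ has Property $( * )_p$, for a prime $p$, if for a (equivalently, every) Sylow $p$-subgroup $P$ of $G$, the stabiliser $P_\omega=P\cap G_\omega$ is a Sylow $p$-subgroup of the point stabiliser $G_\omega$ for every $\omega\in\Omega$. A system of imprimitivity is a $G$-invariant partition of $\Omega$. *)

theory Defs
  imports "HOL-Algebra.Algebra" "HOL-Library.Disjoint_Sets"
begin

definition sylow_subgroup :: "nat \<Rightarrow> ('a, 'c) monoid_scheme \<Rightarrow> 'a set \<Rightarrow> bool" where
  "sylow_subgroup p G P \<longleftrightarrow> subgroup P G \<and> card P = p ^ multiplicity p (order G)"

text \<open>
  Property \<open>(*)\<^sub>p\<close>. It may be stated for some or, equivalently (Sylow subgroups are conjugate), for every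
  Sylow \<open>p\<close>-subgroup \<open>P\<close> of the finite group \<open>G\<close>; here \<open>P\<close> is existentially quantified.
\<close>
definition property_star ::
    "nat \<Rightarrow> ('a, 'c) monoid_scheme \<Rightarrow> 'b set \<Rightarrow> ('a \<Rightarrow> 'b \<Rightarrow> 'b) \<Rightarrow> bool" where
  "property_star p G \<Omega> \<phi> \<longleftrightarrow>
    (\<exists>P. sylow_subgroup p G P \<and>
      (\<forall>\<omega>\<in>\<Omega>. sylow_subgroup p (G\<lparr>carrier := stabilizer G \<phi> \<omega>\<rparr>) (P \<inter> stabilizer G \<phi> \<omega>)))"

definition system_of_imprimitivity ::
    "('a, 'c) monoid_scheme \<Rightarrow> 'b set \<Rightarrow> ('a \<Rightarrow> 'b \<Rightarrow> 'b) \<Rightarrow> 'b set set \<Rightarrow> bool" where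
  "system_of_imprimitivity G \<Omega> \<phi> \<B> \<longleftrightarrow>
    partition_on \<Omega> \<B> \<and> (\<forall>g\<in>carrier G. \<forall>C\<in>\<B>. \<phi> g ` C \<in> \<B>)"

definition setwise_stabilizer ::
    "('a, 'c) monoid_scheme \<Rightarrow> ('a \<Rightarrow> 'b \<Rightarrow> 'b) \<Rightarrow> 'b set \<Rightarrow> 'a set" where
  "setwise_stabilizer G \<phi> B = {g \<in> carrier G. \<phi> g ` B = B}"

text \<open>
  The two induced permutation groups are images in \<^const>\<open>BijGroup\<close>, i.e. the kernel of the
  action on \<open>B\<close> (respectively \<open>\<B>\<close>) has been factored out. Their elements are themselves
  (extensional) permutations, so their natural action is given by \<^term>\<open>\<lambda>f. f\<close>.
\<close>
definition induced_on_block ::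
    "('a, 'c) monoid_scheme \<Rightarrow> ('a \<Rightarrow> 'b \<Rightarrow> 'b) \<Rightarrow> 'b set \<Rightarrow> ('b \<Rightarrow> 'b) monoid" where
  "induced_on_block G \<phi> B =
    (BijGroup B)\<lparr>carrier := (\<lambda>g. \<lambda>x\<in>B. \<phi> g x) ` setwise_stabilizer G \<phi> B\<rparr>"

definition induced_on_blocks ::
    "('a, 'c) monoid_scheme \<Rightarrow> ('a \<Rightarrow> 'b \<Rightarrow> 'b) \<Rightarrow> 'b set set \<Rightarrow> ('b set \<Rightarrow> 'b set) monoid" where
  "induced_on_blocks G \<phi> \<B> =
    (BijGroup \<B>)\<lparr>carrier := (\<lambda>g. \<lambda>C\<in>\<B>. \<phi> g ` C) ` carrier G\<rparr>"

end

theory Submission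
  imports Defs
begin

text \<open>
  By the orbit-stabiliser theorem, a Sylow \<open>p\<close>-subgroup \<open>P\<close> meets a point stabiliser in a Sylow
  subgroup iff the \<open>P\<close>-orbit of the point has as length the \<open>p\<close>-part of the length of its
  \<open>G\<close>-orbit. As orbits do not see the kernel of an action, Property \<open>(*)\<^sub>p\<close> may be tested on \<open>G\<close>
  and \<open>G\<^sub>B\<close> instead of the permutation groups they induce, and by Sylow's conjugacy theorem on any
  Sylow subgroup. For (1), \<open>P \<inter> G\<^sub>B\<close> is Sylow in \<open>G\<^sub>B\<close> because \<open>G\<close> has the property on the blocks,
  hence \<open>P \<inter> G\<^sub>\<omega>\<close> is Sylow in \<open>G\<^sub>\<omega> \<subseteq> G\<^sub>B\<close>. For (2), choose \<open>P\<close> with \<open>P \<inter> G\<^sub>B\<close> Sylow in \<open>G\<^sub>B\<close>.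
  For (3), a regular action always has the property, since its point stabilisers are trivial,
  whereas \<open>S\<^sub>3\<close> on three points lacks it for \<open>p = 2\<close>.
\<close>

section \<open>Sylow subgroups\<close>

lemma sylow_subgroupD:
  assumes "sylow_subgroup p G P"
  shows "subgroup P G" "card P = p ^ multiplicity p (order G)"
  using assms by (auto simp: sylow_subgroup_def)

lemma order_restrict [simp]: "order (G\<lparr>carrier := H\<rparr>) = card H"
  by (simp add: order_def)

lemma (in group) card_subgroup_dvd_order:
  assumes "subgroup H G"
  shows "card H dvd order G"
  using lagrange[OF assms] by (metis dvd_triv_right)

lemma (in group) exists_sylow_subgroup:
  assumes "Factorial_Ring.prime p" "finite (carrier G)"
  shows "\<exists>P. sylow_subgroup p G P"
proof -
  have "p ^ multiplicity p (order G) dvd order G"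
    by (rule multiplicity_dvd)
  then obtain m where "order G = p ^ multiplicity p (order G) * m"
    by (rule dvdE)
  from sylow_thm[OF assms(1) is_group this assms(2)]
  show ?thesis by (simp add: sylow_subgroup_def)
qed

section \<open>Conjugacy of Sylow subgroups\<close>

text \<open>Every orbit length divides \<open>p ^ k\<close>. An orbit of length one is a fixed
  point, so without fixed points \<open>p\<close> divides every orbit length and hence their sum
  \<open>card E\<close>.\<close>

lemma (in group_action) p_group_fixed_point:
  assumes p: "Factorial_Ring.prime p" and ord: "order G = p ^ k"
    and fin: "finite E" and ndvd: "\<not> p dvd card E"
  shows "\<exists>x\<in>E. \<forall>g\<in>carrier G. \<phi> g x = x"
proof (rule ccontr)
  assume nofix: "\<not> ?thesis"
  have "p dvd card (orbit G \<phi> x)" if x: "x \<in> E" for x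
  proof -
    have "card (orbit G \<phi> x) dvd p ^ k"
      using orbit_stabilizer_theorem[OF x] ord by (metis dvd_triv_left)
    then obtain i where i: "card (orbit G \<phi> x) = p ^ i"
      using p by (auto simp: divides_primepow_nat)
    have "i \<noteq> 0"
    proof
      assume "i = 0"
      then obtain y where "orbit G \<phi> x = {y}"
        using i by (auto simp: card_1_singleton_iff)
      with orbit_refl[OF x] have "orbit G \<phi> x = {x}" by auto
      then have "\<forall>g\<in>carrier G. \<phi> g x = x"
        by (auto simp: orbit_def)
      with nofix x show False by blast
    qed
    then show ?thesis using i by simp
  qed
  then have "p dvd (\<Sum>orb\<in>orbits G E \<phi>. card orb)"
    by (auto simp: orbits_def intro!: dvd_sum)
  also have "(\<Sum>orb\<in>orbits G E \<phi>. card orb) = card E"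
    using disjoint_sum[OF fin, of "\<lambda>_. 1::nat"] by simp
  finally show False using ndvd by contradiction
qed

lemma (in group) conjugate_eq_image:
  "g <# H #> inv g = (\<lambda>h. g \<otimes> h \<otimes> inv g) ` H"
  by (auto simp: l_coset_def r_coset_def)

text \<open>Multiplying on the right by \<open>inv g\<close> instead of \<open>g\<close> turns an
  antihomomorphism into a homomorphism, as an action requires.\<close>

lemma (in group) rcosets_action:
  assumes H: "subgroup H G"
  shows "group_action G (rcosets H) (\<lambda>g. \<lambda>C\<in>rcosets H. C #> inv g)"
proof -
  have closed: "C #> g \<in> rcosets H" if "C \<in> rcosets H" "g \<in> carrier G" for C g
    using that subgroup.subset[OF H] by (auto simp: RCOSETS_def coset_mult_assoc)
  have sub: "C \<subseteq> carrier G" if "C \<in> rcosets H" for C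
    using that subgroup.rcosets_carrier[OF H is_group] by blast
  have bij: "(\<lambda>C\<in>rcosets H. C #> inv g) \<in> Bij (rcosets H)" if g: "g \<in> carrier G" for g
  proof -
    have "bij_betw (\<lambda>C. C #> inv g) (rcosets H) (rcosets H)"
      by (rule bij_betw_byWitness[where f' = "\<lambda>C. C #> g"])
        (use g sub closed in \<open>auto simp: coset_mult_assoc\<close>)
    then show ?thesis by (auto simp: Bij_def cong: bij_betw_cong)
  qed
  have "(\<lambda>g. \<lambda>C\<in>rcosets H. C #> inv g) \<in> hom G (BijGroup (rcosets H))"
    by (rule homI)
      (use bij sub closed in \<open>auto simp: BijGroup_def inv_mult_group compose_def coset_mult_assoc
        intro!: restrict_ext\<close>)
  then show ?thesis
    by (simp add: group_action_def group_hom_def group_hom_axioms_def group_BijGroup is_group)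
qed

text \<open>Let \<open>R\<close> act on the right cosets of \<open>P\<close>. Their number is prime
  to \<open>p\<close>, so \<open>R\<close> fixes some coset \<open>P #> x\<close>, which says that
  \<open>x\<close> conjugates \<open>R\<close> into \<open>P\<close>.\<close>

lemma (in group) p_subgroup_in_conjugate_sylow:
  assumes p: "Factorial_Ring.prime p" and fin: "finite (carrier G)"
    and P: "sylow_subgroup p G P" and R: "subgroup R G" and cR: "card R = p ^ k"
  shows "\<exists>g\<in>carrier G. R \<subseteq> g <# P #> inv g"
proof -
  note sP = sylow_subgroupD(1)[OF P]
  have "\<not> p dvd card (rcosets P)"
  proof
    assume "p dvd card (rcosets P)"
    \<comment> \<open>Otherwise a power of \<open>p\<close> above the full \<open>p\<close>-part
      would divide the group order.\<close>
    then have "p * card P dvd order G"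
      using lagrange[OF sP] by (metis dvd_refl mult_dvd_mono)
    then have "p ^ Suc (multiplicity p (order G)) dvd order G"
      using sylow_subgroupD(2)[OF P] by simp
    moreover have "order G \<noteq> 0"
      using fin by (metis order_gt_0_iff_finite less_not_refl)
    ultimately show False
      using p by (metis Suc_n_not_le_n not_prime_unit power_dvd_iff_le_multiplicity)
  qed
  moreover have "finite (rcosets P)"
    using fin by (simp add: RCOSETS_def)
  ultimately obtain C where C: "C \<in> rcosets P" "\<forall>g\<in>R. C #> inv g = C"
    using group_action.p_group_fixed_point
      [OF group_action.induced_action[OF rcosets_action[OF sP] R] p, of k] cR
    by auto
  then obtain x where x: "x \<in> carrier G" "C = P #> x"
    by (auto simp: RCOSETS_def)
  have "R \<subseteq> inv x <# P #> inv (inv x)"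
  proof
    fix r assume r: "r \<in> R"
    then have rG: "r \<in> carrier G" using subgroup.subset[OF R] by blast
    \<comment> \<open>The fixed coset is used at the inverse of \<open>r\<close>, because the action
      itself inverts.\<close>
    have "P #> x #> inv (inv r) = P #> x"
      using C(2) x subgroup.m_inv_closed[OF R r] by metis
    then have "P #> (x \<otimes> r) = P #> x"
      using x rG subgroup.subset[OF sP] by (simp add: coset_mult_assoc)
    then have "x \<otimes> r \<in> P #> x"
      using rcos_self[OF _ sP, of "x \<otimes> r"] x rG by auto
    then obtain h where h: "h \<in> P" "x \<otimes> r = h \<otimes> x"
      by (auto simp: r_coset_def)
    then have "h \<in> carrier G" using subgroup.subset[OF sP] by blast
    then have "r = inv x \<otimes> h \<otimes> inv (inv x)"
      using h(2) x rG by (metis inv_closed inv_inv inv_solve_left m_assoc m_closed)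
    with h(1) show "r \<in> inv x <# P #> inv (inv x)"
      by (auto simp: conjugate_eq_image)
  qed
  with x show ?thesis by blast
qed

lemma (in group) sylow_conjugate:
  assumes P: "sylow_subgroup p G P" and g: "g \<in> carrier G"
  shows "sylow_subgroup p G (g <# P #> inv g)"
proof -
  note sP = sylow_subgroupD[OF P]
  have "inj_on (\<lambda>h. g \<otimes> h \<otimes> inv g) P"
    using conjugation_is_inj[OF g] subgroup.subset[OF sP(1)] by (intro inj_onI) blast
  then have "card (g <# P #> inv g) = card P"
    by (simp add: conjugate_eq_image card_image)
  then show ?thesis
    using sP subgroup_conjugation_is_surj2[OF g sP(1)] by (simp add: sylow_subgroup_def)
qed

text \<open>One Sylow subgroup lies in a conjugate of the other, and both have the same finite
  order.\<close>

lemma (in group) sylow_subgroups_conjugate: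
  assumes p: "Factorial_Ring.prime p" and fin: "finite (carrier G)"
    and P: "sylow_subgroup p G P" and Q: "sylow_subgroup p G Q"
  obtains g where "g \<in> carrier G" "Q = g <# P #> inv g"
proof -
  obtain g where g: "g \<in> carrier G" "Q \<subseteq> g <# P #> inv g"
    using p_subgroup_in_conjugate_sylow[OF p fin P sylow_subgroupD[OF Q]] by blast
  note C = sylow_subgroupD[OF sylow_conjugate[OF P g(1)]]
  have "finite (g <# P #> inv g)"
    using subgroup.subset[OF C(1)] fin finite_subset by blast
  then have "Q = g <# P #> inv g"
    using g(2) C(2) sylow_subgroupD(2)[OF Q] by (simp add: card_subset_eq)
  with g(1) that show ?thesis by blast
qed

text \<open>A Sylow subgroup \<open>R\<close> of \<open>S\<close> lies in some Sylow subgroup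
  \<open>P\<close> of \<open>G\<close>. Then \<open>P \<inter> S\<close> is a
  \<open>p\<close>-subgroup of \<open>S\<close> containing \<open>R\<close>, so it cannot be larger
  than \<open>R\<close>.\<close>

lemma (in group) sylow_restrict_subgroup:
  assumes p: "Factorial_Ring.prime p" and fin: "finite (carrier G)" and S: "subgroup S G"
  obtains P where "sylow_subgroup p G P" "sylow_subgroup p (G\<lparr>carrier := S\<rparr>) (P \<inter> S)"
proof -
  have finS: "finite S" using subgroup.subset[OF S] fin finite_subset by blast
  interpret S: group "G\<lparr>carrier := S\<rparr>" by (rule subgroup_imp_group[OF S])
  obtain R where R: "sylow_subgroup p (G\<lparr>carrier := S\<rparr>) R"
    using S.exists_sylow_subgroup[OF p] finS by auto
  note sR = sylow_subgroupD[OF R]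
  have RS: "R \<subseteq> S" using subgroup.subset[OF sR(1)] by simp
  obtain P0 where P0: "sylow_subgroup p G P0"
    using exists_sylow_subgroup[OF p fin] by blast
  obtain g where g: "g \<in> carrier G" "R \<subseteq> g <# P0 #> inv g"
    using p_subgroup_in_conjugate_sylow[OF p fin P0 incl_subgroup[OF S sR(1)] sR(2)] by blast
  define P where "P = g <# P0 #> inv g"
  have P: "sylow_subgroup p G P"
    unfolding P_def by (rule sylow_conjugate[OF P0 g(1)])
  note sP = sylow_subgroupD[OF P]
  have PS: "subgroup (P \<inter> S) G" using sP(1) S by (rule subgroups_Inter_pair)
  have "card (P \<inter> S) dvd p ^ multiplicity p (order G)"
    using group.card_subgroup_dvd_order[OF subgroup_imp_group[OF sP(1)] subgroup_incl[OF PS sP(1)]]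
      sP(2) by simp
  then obtain i where i: "card (P \<inter> S) = p ^ i"
    using p by (auto simp: divides_primepow_nat)
  have "card S \<noteq> 0"
    using finS subgroup.one_closed[OF S] by auto
  moreover have "p ^ i dvd card S"
    using S.card_subgroup_dvd_order[OF subgroup_incl[OF PS S]] i by simp
  ultimately have "i \<le> multiplicity p (card S)"
    using p by (metis not_prime_unit power_dvd_iff_le_multiplicity)
  then have "card (P \<inter> S) \<le> card R"
    using i sR(2) prime_gt_0_nat[OF p] by (simp add: power_increasing)
  then have "R = P \<inter> S"
    using g(2) RS finS unfolding P_def by (intro card_seteq) auto
  with P R that show ?thesis by blast
qed

section \<open>Sylow subgroups under surjective homomorphisms\<close>

lemma (in group_hom) order_times_card_kernel:
  assumes "h ` carrier G = carrier H"
  shows "order H * card (kernel G H h) = order G"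
proof -
  have "bij_betw (\<lambda>C. the_elem (h ` C)) (carrier (G Mod kernel G H h)) (carrier H)"
    using FactGroup_iso_set[OF assms] by (simp add: iso_def)
  then have "card (carrier (G Mod kernel G H h)) = order H"
    by (simp add: order_def bij_betw_same_card)
  then show ?thesis
    using G.lagrange[OF subgroup_kernel] by (simp add: FactGroup_def)
qed

text \<open>Restricting \<open>h\<close> to \<open>P\<close> splits the order of \<open>P\<close>
  into \<open>p ^ c\<close> for the image and \<open>p ^ d\<close> for \<open>P \<inter> ?K\<close>.
  Both exponents are bounded by the multiplicities of \<open>p\<close> in \<open>order H\<close> and
  \<open>card ?K\<close>. As \<open>c + d\<close> is the sum of these bounds, both are
  attained.\<close>

lemma (in group_hom) sylow_image:
  assumes p: "Factorial_Ring.prime p" and fin: "finite (carrier G)"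
    and surj: "h ` carrier G = carrier H" and P: "sylow_subgroup p G P"
  shows "sylow_subgroup p H (h ` P)"
proof -
  note sP = sylow_subgroupD[OF P]
  let ?K = "kernel G H h"
  have hP: "subgroup (h ` P) H" by (rule subgroup_img_is_subgroup[OF sP(1)])
  interpret P: group_hom "G\<lparr>carrier := P\<rparr>" "H\<lparr>carrier := h ` P\<rparr>" h
    using G.subgroup_imp_group[OF sP(1)] H.subgroup_imp_group[OF hP] subgroup.subset[OF sP(1)]
    by (auto simp: group_hom_def group_hom_axioms_def hom_def subset_eq)
  have K: "kernel (G\<lparr>carrier := P\<rparr>) (H\<lparr>carrier := h ` P\<rparr>) h = P \<inter> ?K"
    using subgroup.subset[OF sP(1)] by (auto simp: kernel_def)
  have eqP: "card (h ` P) * card (P \<inter> ?K) = p ^ multiplicity p (order G)"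
    using P.order_times_card_kernel sP(2) by (simp add: K)
  have eqG: "order H * card ?K = order G"
    by (rule order_times_card_kernel[OF surj])
  have ord: "order G \<noteq> 0"
    using fin by (metis G.order_gt_0_iff_finite less_not_refl)
  then have nz: "order H \<noteq> 0" "card ?K \<noteq> 0" using eqG by (metis mult_is_0)+
  obtain c where c: "card (h ` P) = p ^ c"
    using eqP p by (metis divides_primepow_nat dvd_triv_left)
  obtain d where d: "card (P \<inter> ?K) = p ^ d"
    using eqP p by (metis divides_primepow_nat dvd_triv_right)
  have PK: "subgroup (P \<inter> ?K) G"
    using sP(1) subgroup_kernel by (rule G.subgroups_Inter_pair)
  have "p ^ c dvd order H"
    using H.card_subgroup_dvd_order[OF hP] c by simp
  then have c_le: "c \<le> multiplicity p (order H)"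
    using p nz(1) by (metis not_prime_unit power_dvd_iff_le_multiplicity)
  have "p ^ d dvd card ?K"
    using group.card_subgroup_dvd_order[OF G.subgroup_imp_group[OF subgroup_kernel]
        G.subgroup_incl[OF PK subgroup_kernel]] d by simp
  then have d_le: "d \<le> multiplicity p (card ?K)"
    using p nz(2) by (metis not_prime_unit power_dvd_iff_le_multiplicity)
  have "p ^ (c + d) = p ^ multiplicity p (order G)"
    using eqP c d by (simp add: power_add)
  then have "c + d = multiplicity p (order G)"
    using prime_gt_1_nat[OF p] by simp
  also have "\<dots> = multiplicity p (order H) + multiplicity p (card ?K)"
    using p nz by (simp flip: eqG add: prime_elem_multiplicity_mult_distrib)
  finally have "c = multiplicity p (order H)"
    using c_le d_le by linarith
  with hP c show ?thesis by (simp add: sylow_subgroup_def)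
qed

section \<open>Property \<open>(*)\<^sub>p\<close> in terms of orbits\<close>

text \<open>The orbit-stabiliser theorem for \<open>G\<close> and for \<open>P\<close> gives two
  factorisations of the \<open>p\<close>-part of \<open>order G\<close>. The resulting criterion
  mentions orbit lengths only, which survive conjugation and factoring out a kernel.\<close>

lemma (in group_action) sylow_stabilizer_iff_card_orbit:
  assumes p: "Factorial_Ring.prime p" and fin: "finite (carrier G)"
    and P: "sylow_subgroup p G P" and x: "x \<in> E"
  shows "sylow_subgroup p (G\<lparr>carrier := stabilizer G \<phi> x\<rparr>) (P \<inter> stabilizer G \<phi> x) \<longleftrightarrow>
    card (orbit (G\<lparr>carrier := P\<rparr>) \<phi> x) = p ^ multiplicity p (card (orbit G \<phi> x))"
proof -
  interpret G: group G by (rule group_hom.axioms(1)[OF group_hom])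
  note sP = sylow_subgroupD[OF P]
  let ?S = "stabilizer G \<phi> x"
  have S: "subgroup ?S G" by (rule stabilizer_subgroup[OF x])
  have "subgroup (P \<inter> ?S) (G\<lparr>carrier := ?S\<rparr>)"
    using G.subgroup_incl[OF G.subgroups_Inter_pair[OF sP(1) S] S] by simp
  moreover have eqG: "card (orbit G \<phi> x) * card ?S = order G"
    by (rule orbit_stabilizer_theorem[OF x])
  have "stabilizer (G\<lparr>carrier := P\<rparr>) \<phi> x = P \<inter> ?S"
    using subgroup.subset[OF sP(1)] by (auto simp: stabilizer_def)
  then have eqP: "card (orbit (G\<lparr>carrier := P\<rparr>) \<phi> x) * card (P \<inter> ?S)
      = p ^ multiplicity p (order G)"
    using group_action.orbit_stabilizer_theorem[OF induced_action[OF sP(1)] x] sP(2) by simp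
  have "order G \<noteq> 0"
    using fin by (metis G.order_gt_0_iff_finite less_not_refl)
  then have "card (orbit G \<phi> x) \<noteq> 0" "card ?S \<noteq> 0" using eqG by (metis mult_is_0)+
  then have "multiplicity p (order G) = multiplicity p (card (orbit G \<phi> x)) + multiplicity p (card ?S)"
    using p by (simp flip: eqG add: prime_elem_multiplicity_mult_distrib)
  then have eq: "card (orbit (G\<lparr>carrier := P\<rparr>) \<phi> x) * card (P \<inter> ?S)
      = p ^ multiplicity p (card (orbit G \<phi> x)) * p ^ multiplicity p (card ?S)"
    using eqP by (simp add: power_add)
  \<comment> \<open>In an equation of two nonzero products, equality of one pair of factors forces
    equality of the other.\<close>
  have "card (P \<inter> ?S) = p ^ multiplicity p (card ?S) \<longleftrightarrow>
      card (orbit (G\<lparr>carrier := P\<rparr>) \<phi> x) = p ^ multiplicity p (card (orbit G \<phi> x))"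
    using eq prime_gt_0_nat[OF p]
    by (metis mult_cancel1 mult_cancel2 power_not_zero less_not_refl)
  ultimately show ?thesis by (simp add: sylow_subgroup_def)
qed

lemma (in group_action) orbit_conjugate:
  assumes P: "P \<subseteq> carrier G" and g: "g \<in> carrier G" and x: "x \<in> E"
  shows "orbit (G\<lparr>carrier := g <#\<^bsub>G\<^esub> P #>\<^bsub>G\<^esub> inv\<^bsub>G\<^esub> g\<rparr>) \<phi> (\<phi> g x) =
    \<phi> g ` orbit (G\<lparr>carrier := P\<rparr>) \<phi> x"
proof -
  interpret G: group G by (rule group_hom.axioms(1)[OF group_hom])
  have "\<phi> (g \<otimes> h \<otimes> inv g) (\<phi> g x) = \<phi> g (\<phi> h x)" if "h \<in> P" for h
  proof -
    have h: "h \<in> carrier G" using that P by blast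
    have gx: "\<phi> g x \<in> E" by (rule element_image[OF g x refl])
    show ?thesis
      using x g h gx orbit_sym_aux[OF g x refl] by (simp add: composition_rule)
  qed
  then show ?thesis
    by (force simp: orbit_def G.conjugate_eq_image)
qed

text \<open>The orbit of \<open>\<phi> g x\<close> under the conjugate of \<open>P\<close> is the
  image under \<open>g\<close> of the \<open>P\<close>-orbit of \<open>x\<close>, so the lengths
  agree; the \<open>G\<close>-orbit is the same for both points.\<close>

lemma (in group_action) sylow_stabilizer_conjugate:
  assumes p: "Factorial_Ring.prime p" and fin: "finite (carrier G)"
    and P: "sylow_subgroup p G P" and x: "x \<in> E" and g: "g \<in> carrier G"
    and syl: "sylow_subgroup p (G\<lparr>carrier := stabilizer G \<phi> x\<rparr>) (P \<inter> stabilizer G \<phi> x)"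
  shows "sylow_subgroup p (G\<lparr>carrier := stabilizer G \<phi> (\<phi> g x)\<rparr>)
    ((g <#\<^bsub>G\<^esub> P #>\<^bsub>G\<^esub> inv\<^bsub>G\<^esub> g) \<inter> stabilizer G \<phi> (\<phi> g x))"
proof -
  interpret G: group G by (rule group_hom.axioms(1)[OF group_hom])
  have PG: "P \<subseteq> carrier G" by (rule subgroup.subset[OF sylow_subgroupD(1)[OF P]])
  have gx: "\<phi> g x \<in> E" by (rule element_image[OF g x refl])
  have inj: "card (\<phi> g ` A) = card A" if "A \<subseteq> E" for A
    by (rule card_image[OF inj_on_subset[OF inj_prop[OF g] that]])
  have "orbit (G\<lparr>carrier := P\<rparr>) \<phi> x \<subseteq> E"
    using PG element_image[OF _ x refl] by (auto simp: orbit_def)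
  then have "card (orbit (G\<lparr>carrier := g <# P #> inv g\<rparr>) \<phi> (\<phi> g x)) = card (orbit (G\<lparr>carrier := P\<rparr>) \<phi> x)"
    by (simp add: orbit_conjugate[OF PG g x] inj)
  also have "\<dots> = p ^ multiplicity p (card (orbit G \<phi> x))"
    using syl sylow_stabilizer_iff_card_orbit[OF p fin P x] by blast
  also have "orbit G \<phi> x = orbit G \<phi> (\<phi> g x)"
  proof -
    have "\<phi> g x \<in> orbit G \<phi> x" using g by (auto simp: orbit_def)
    moreover have "orbit G \<phi> y \<subseteq> E" if "y \<in> E" for y
      using element_image[OF _ that refl] by (auto simp: orbit_def)
    ultimately show ?thesis
      using orbit_trans orbit_sym x gx by (meson subset_antisym subsetI subset_iff)
  qed
  finally show ?thesis
    using sylow_stabilizer_iff_card_orbit[OF p fin G.sylow_conjugate[OF P g] gx] by blast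
qed

text \<open>This makes the choice of Sylow subgroup in \<open>property_star\<close> immaterial: if
  \<open>P\<close> is the conjugate of \<open>Q\<close> by \<open>g\<close>, the condition for
  \<open>P\<close> at \<open>\<phi> g y\<close> follows from that for \<open>Q\<close> at
  \<open>y\<close>.\<close>

lemma (in group_action) property_star_iff:
  assumes p: "Factorial_Ring.prime p" and fin: "finite (carrier G)" and P: "sylow_subgroup p G P"
  shows "property_star p G E \<phi> \<longleftrightarrow>
    (\<forall>x\<in>E. sylow_subgroup p (G\<lparr>carrier := stabilizer G \<phi> x\<rparr>) (P \<inter> stabilizer G \<phi> x))"
proof
  interpret G: group G by (rule group_hom.axioms(1)[OF group_hom])
  assume "property_star p G E \<phi>"
  then obtain Q where Q: "sylow_subgroup p G Q" and
    star: "\<And>x. x \<in> E \<Longrightarrow> sylow_subgroup p (G\<lparr>carrier := stabilizer G \<phi> x\<rparr>) (Q \<inter> stabilizer G \<phi> x)"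
    unfolding property_star_def by blast
  obtain g where g: "g \<in> carrier G" "P = g <# Q #> inv g"
    using G.sylow_subgroups_conjugate[OF p fin Q P] by blast
  show "\<forall>x\<in>E. sylow_subgroup p (G\<lparr>carrier := stabilizer G \<phi> x\<rparr>) (P \<inter> stabilizer G \<phi> x)"
  proof
    fix x assume x: "x \<in> E"
    then obtain y where "y \<in> E" "\<phi> g y = x" using bij_prop1[OF g(1)] by blast
    then show "sylow_subgroup p (G\<lparr>carrier := stabilizer G \<phi> x\<rparr>) (P \<inter> stabilizer G \<phi> x)"
      using sylow_stabilizer_conjugate[OF p fin Q _ g(1) star] g(2) by blast
  qed
next
  assume "\<forall>x\<in>E. sylow_subgroup p (G\<lparr>carrier := stabilizer G \<phi> x\<rparr>) (P \<inter> stabilizer G \<phi> x)"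
  with P show "property_star p G E \<phi>" unfolding property_star_def by blast
qed

text \<open>One point suffices if all Sylow subgroups are tested there: the condition for
  \<open>P\<close> at \<open>\<phi> g x\<close> comes from the one for the conjugate of
  \<open>P\<close> by \<open>inv g\<close> at \<open>x\<close>.\<close>

lemma (in transitive_action) property_star_pointI:
  assumes p: "Factorial_Ring.prime p" and fin: "finite (carrier G)" and x: "x \<in> E"
    and star: "\<And>P. sylow_subgroup p G P \<Longrightarrow>
      sylow_subgroup p (G\<lparr>carrier := stabilizer G \<phi> x\<rparr>) (P \<inter> stabilizer G \<phi> x)"
  shows "property_star p G E \<phi>"
proof -
  interpret G: group G by (rule group_hom.axioms(1)[OF group_hom])
  obtain P where P: "sylow_subgroup p G P" using G.exists_sylow_subgroup[OF p fin] by blast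
  have sub: "P \<subseteq> carrier G" by (rule subgroup.subset[OF sylow_subgroupD(1)[OF P]])
  have "sylow_subgroup p (G\<lparr>carrier := stabilizer G \<phi> y\<rparr>) (P \<inter> stabilizer G \<phi> y)"
    if y: "y \<in> E" for y
  proof -
    obtain g where g: "g \<in> carrier G" "\<phi> g x = y" using unique_orbit[OF x y] by blast
    have Q: "sylow_subgroup p G (inv g <# P #> inv (inv g))"
      using G.sylow_conjugate[OF P] g(1) by blast
    have "g <# (inv g <# P #> g) #> inv g = P"
      by (rule G.subgroup_conjugation_is_surj0[OF g(1) sub])
    then show ?thesis
      using sylow_stabilizer_conjugate[OF p fin Q x g(1) star[OF Q]] g by simp
  qed
  with P show ?thesis unfolding property_star_def by blast
qed

lemma (in group_action) property_star_image_iff: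
  assumes p: "Factorial_Ring.prime p" and fin: "finite (carrier G)"
  shows "property_star p ((BijGroup E)\<lparr>carrier := \<phi> ` carrier G\<rparr>) E (\<lambda>f. f) \<longleftrightarrow>
    property_star p G E \<phi>"
proof -
  interpret group_hom G "BijGroup E" \<phi> by (rule group_hom)
  let ?H = "(BijGroup E)\<lparr>carrier := \<phi> ` carrier G\<rparr>"
  have H: "group ?H" by (rule H.subgroup_imp_group[OF img_is_subgroup])
  interpret H: group_action ?H E "\<lambda>f. f"
    using H img_is_subgroup subgroup.subset[OF img_is_subgroup]
    by (auto simp: group_action_def group_hom_def group_hom_axioms_def group_BijGroup hom_def)
  have hom: "group_hom G ?H \<phi>"
    using H G.is_group by (auto simp: group_hom_def group_hom_axioms_def hom_def)
  obtain P where P: "sylow_subgroup p G P" using G.exists_sylow_subgroup[OF p fin] by blast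
  have Q: "sylow_subgroup p ?H (\<phi> ` P)"
    using group_hom.sylow_image[OF hom p fin _ P] by simp
  have "orbit (?H\<lparr>carrier := \<phi> ` A\<rparr>) (\<lambda>f. f) x = orbit (G\<lparr>carrier := A\<rparr>) \<phi> x" for A x
    by (auto simp: orbit_def)
  moreover have "orbit ?H (\<lambda>f. f) x = orbit G \<phi> x" for x
    by (auto simp: orbit_def)
  ultimately show ?thesis
    using H.property_star_iff[OF p _ Q] property_star_iff[OF p fin P]
      H.sylow_stabilizer_iff_card_orbit[OF p _ Q] sylow_stabilizer_iff_card_orbit[OF p fin P] fin
    by simp
qed

section \<open>Blocks\<close>

locale imprimitive_action = transitive_action +
  fixes \<B>
  assumes imprimitive: "system_of_imprimitivity G E \<phi> \<B>"
begin

sublocale G: group G by (rule group_hom.axioms(1)[OF group_hom])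

text \<open>The restriction makes each map extensional, as membership in \<open>Bij \<B>\<close>
  demands.\<close>

definition block_action where
  "block_action g = (\<lambda>C\<in>\<B>. \<phi> g ` C)"

lemma block_subset: "C \<in> \<B> \<Longrightarrow> C \<subseteq> E"
  using imprimitive by (auto simp: system_of_imprimitivity_def partition_on_def)

lemma block_image: "g \<in> carrier G \<Longrightarrow> C \<in> \<B> \<Longrightarrow> \<phi> g ` C \<in> \<B>"
  using imprimitive by (auto simp: system_of_imprimitivity_def)

lemma image_mult:
  assumes "g \<in> carrier G" "h \<in> carrier G" "C \<in> \<B>"
  shows "\<phi> (g \<otimes> h) ` C = \<phi> g ` (\<phi> h ` C)"
  using assms block_subset[OF assms(3)]
  by (force simp: image_image composition_rule subset_eq intro!: image_cong)

lemma image_one: "C \<in> \<B> \<Longrightarrow> \<phi> \<one> ` C = C"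
  using block_subset by (force simp flip: id_eq_one)

lemma block_group_action: "group_action G \<B> block_action"
proof -
  have bij: "block_action g \<in> Bij \<B>" if g: "g \<in> carrier G" for g
  proof -
    have "bij_betw (\<lambda>C. \<phi> g ` C) \<B> \<B>"
      by (rule bij_betw_byWitness[where f' = "\<lambda>C. \<phi> (inv g) ` C"])
        (use g block_image in \<open>auto simp: image_one simp flip: image_mult\<close>)
    then show ?thesis by (auto simp: Bij_def block_action_def cong: bij_betw_cong)
  qed
  have "block_action (g \<otimes> h) = compose \<B> (block_action g) (block_action h)"
    if "g \<in> carrier G" "h \<in> carrier G" for g h
    unfolding block_action_def compose_def using that
    by (intro restrict_ext) (simp add: image_mult block_image)
  then have "block_action \<in> hom G (BijGroup \<B>)"
    using bij by (intro homI) (simp_all add: BijGroup_def)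
  then show ?thesis
    by (simp add: group_action_def group_hom_def group_hom_axioms_def group_BijGroup)
qed

lemma induced_on_blocks_eq:
  "induced_on_blocks G \<phi> \<B> = (BijGroup \<B>)\<lparr>carrier := block_action ` carrier G\<rparr>"
  by (simp add: induced_on_blocks_def block_action_def[abs_def])

lemma setwise_stabilizer_eq:
  "B \<in> \<B> \<Longrightarrow> setwise_stabilizer G \<phi> B = stabilizer G block_action B"
  by (simp add: setwise_stabilizer_def stabilizer_def block_action_def)

lemma setwise_stabilizer_subgroup:
  "B \<in> \<B> \<Longrightarrow> subgroup (setwise_stabilizer G \<phi> B) G"
  by (simp add: setwise_stabilizer_eq group_action.stabilizer_subgroup[OF block_group_action])

lemma block_eq:
  assumes "B \<in> \<B>" "C \<in> \<B>" "x \<in> B" "x \<in> C"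
  shows "B = C"
  using assms imprimitive
  by (auto simp: system_of_imprimitivity_def partition_on_def disjoint_def)

text \<open>If \<open>g\<close> fixes \<open>x\<close>, then \<open>B\<close> and its image under
  \<open>g\<close> are blocks sharing \<open>x\<close>, hence equal.\<close>

lemma stabilizer_subset_setwise_stabilizer:
  assumes B: "B \<in> \<B>" and x: "x \<in> B"
  shows "stabilizer G \<phi> x \<subseteq> setwise_stabilizer G \<phi> B"
proof
  fix g assume "g \<in> stabilizer G \<phi> x"
  then have g: "g \<in> carrier G" "\<phi> g x = x" by (auto simp: stabilizer_def)
  then have "x \<in> \<phi> g ` B" using x by force
  then have "\<phi> g ` B = B" using block_eq[OF block_image[OF g(1) B] B] x by blast
  with g show "g \<in> setwise_stabilizer G \<phi> B" by (simp add: setwise_stabilizer_def)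
qed

lemma action_on_block:
  assumes B: "B \<in> \<B>"
  shows "group_action (G\<lparr>carrier := setwise_stabilizer G \<phi> B\<rparr>) B (\<lambda>g. \<lambda>x\<in>B. \<phi> g x)"
proof -
  let ?S = "setwise_stabilizer G \<phi> B"
  have S: "group (G\<lparr>carrier := ?S\<rparr>)"
    by (rule G.subgroup_imp_group[OF setwise_stabilizer_subgroup[OF B]])
  have bij: "(\<lambda>x\<in>B. \<phi> g x) \<in> Bij B" if "g \<in> ?S" for g
  proof -
    have g: "g \<in> carrier G" "\<phi> g ` B = B" using that by (auto simp: setwise_stabilizer_def)
    have "inj_on (\<phi> g) B" by (rule inj_on_subset[OF inj_prop[OF g(1)] block_subset[OF B]])
    with g(2) have "bij_betw (\<phi> g) B B" by (simp add: bij_betw_def)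
    then show ?thesis by (auto simp: Bij_def cong: bij_betw_cong)
  qed
  have "(\<lambda>x\<in>B. \<phi> (g \<otimes> h) x) = compose B (\<lambda>x\<in>B. \<phi> g x) (\<lambda>x\<in>B. \<phi> h x)"
    if "g \<in> ?S" "h \<in> ?S" for g h
    using that block_subset[OF B]
    by (auto simp: compose_def setwise_stabilizer_def composition_rule subset_eq intro!: restrict_ext)
  then have "(\<lambda>g. \<lambda>x\<in>B. \<phi> g x) \<in> hom (G\<lparr>carrier := ?S\<rparr>) (BijGroup B)"
    using bij by (intro homI) (simp_all add: BijGroup_def)
  with S show ?thesis
    by (simp add: group_action_def group_hom_def group_hom_axioms_def group_BijGroup)
qed

lemma stabilizer_on_block:
  assumes B: "B \<in> \<B>" and x: "x \<in> B"
  shows "stabilizer (G\<lparr>carrier := setwise_stabilizer G \<phi> B\<rparr>) (\<lambda>g. \<lambda>x\<in>B. \<phi> g x) x = stabilizer G \<phi> x"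
  using stabilizer_subset_setwise_stabilizer[OF B x] x
  by (auto simp: stabilizer_def setwise_stabilizer_def)

section \<open>Transfer of the property between blocks and the whole set\<close>

text \<open>The kernel of the action of the setwise stabiliser on \<open>B\<close> can be ignored.
  Points of \<open>B\<close> have the same stabiliser there as in \<open>G\<close>, so the test with
  \<open>P \<inter> setwise_stabilizer G \<phi> B\<close> becomes a test with \<open>P\<close> on
  the points of \<open>B\<close>.\<close>

lemma property_star_induced_on_block_iff:
  assumes p: "Factorial_Ring.prime p" and fin: "finite (carrier G)" and B: "B \<in> \<B>"
    and P: "sylow_subgroup p (G\<lparr>carrier := setwise_stabilizer G \<phi> B\<rparr>) (P \<inter> setwise_stabilizer G \<phi> B)"
  shows "property_star p (induced_on_block G \<phi> B) B (\<lambda>f. f) \<longleftrightarrow>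
    (\<forall>x\<in>B. sylow_subgroup p (G\<lparr>carrier := stabilizer G \<phi> x\<rparr>) (P \<inter> stabilizer G \<phi> x))"
proof -
  let ?S = "setwise_stabilizer G \<phi> B"
  interpret S: group_action "G\<lparr>carrier := ?S\<rparr>" B "\<lambda>g. \<lambda>x\<in>B. \<phi> g x"
    by (rule action_on_block[OF B])
  have finS: "finite (carrier (G\<lparr>carrier := ?S\<rparr>))"
    using fin by (simp add: setwise_stabilizer_def)
  have Int: "P \<inter> ?S \<inter> stabilizer G \<phi> x = P \<inter> stabilizer G \<phi> x" if "x \<in> B" for x
    using stabilizer_subset_setwise_stabilizer[OF B that] by blast
  have "property_star p (induced_on_block G \<phi> B) B (\<lambda>f. f) \<longleftrightarrow>
      property_star p (G\<lparr>carrier := ?S\<rparr>) B (\<lambda>g. \<lambda>x\<in>B. \<phi> g x)"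
    using S.property_star_image_iff[OF p finS] by (simp add: induced_on_block_def)
  also have "\<dots> \<longleftrightarrow> (\<forall>x\<in>B. sylow_subgroup p (G\<lparr>carrier := stabilizer G \<phi> x\<rparr>) (P \<inter> stabilizer G \<phi> x))"
    using S.property_star_iff[OF p finS P] by (simp add: stabilizer_on_block[OF B] Int)
  finally show ?thesis .
qed

text \<open>By transitivity one point \<open>x\<close> of \<open>B\<close> is enough. The hypothesis
  on the blocks, read at \<open>B\<close> as a point, makes \<open>P\<close> meet the setwise
  stabiliser in a Sylow subgroup; the hypothesis on \<open>B\<close> then descends to the stabiliser
  of \<open>x\<close>.\<close>

lemma property_star_if_blocks:
  assumes p: "Factorial_Ring.prime p" and fin: "finite (carrier G)" and B: "B \<in> \<B>"
    and star_B: "property_star p (induced_on_block G \<phi> B) B (\<lambda>f. f)"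
    and star_blocks: "property_star p (induced_on_blocks G \<phi> \<B>) \<B> (\<lambda>f. f)"
  shows "property_star p G E \<phi>"
proof -
  interpret blocks: group_action G \<B> block_action by (rule block_group_action)
  obtain x where x: "x \<in> B"
    using B imprimitive by (fastforce simp: system_of_imprimitivity_def partition_on_def)
  show ?thesis
  proof (rule property_star_pointI[OF p fin])
    show "x \<in> E" using x block_subset[OF B] by blast
  next
    fix P assume P: "sylow_subgroup p G P"
    have "property_star p G \<B> block_action"
      using star_blocks blocks.property_star_image_iff[OF p fin] by (simp add: induced_on_blocks_eq)
    then have "sylow_subgroup p (G\<lparr>carrier := setwise_stabilizer G \<phi> B\<rparr>) (P \<inter> setwise_stabilizer G \<phi> B)"
      using blocks.property_star_iff[OF p fin P] B by (simp add: setwise_stabilizer_eq)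
    then show "sylow_subgroup p (G\<lparr>carrier := stabilizer G \<phi> x\<rparr>) (P \<inter> stabilizer G \<phi> x)"
      using property_star_induced_on_block_iff[OF p fin B] star_B x by blast
  qed
qed

text \<open>A Sylow subgroup is chosen that meets the setwise stabiliser in a Sylow subgroup. The
  property of \<open>G\<close> may be tested on this particular choice.\<close>

lemma property_star_induced_on_block:
  assumes p: "Factorial_Ring.prime p" and fin: "finite (carrier G)" and B: "B \<in> \<B>"
    and star: "property_star p G E \<phi>"
  shows "property_star p (induced_on_block G \<phi> B) B (\<lambda>f. f)"
proof -
  obtain P where P: "sylow_subgroup p G P"
    "sylow_subgroup p (G\<lparr>carrier := setwise_stabilizer G \<phi> B\<rparr>) (P \<inter> setwise_stabilizer G \<phi> B)"
    using G.sylow_restrict_subgroup[OF p fin setwise_stabilizer_subgroup[OF B]] by blast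
  then show ?thesis
    using property_star_induced_on_block_iff[OF p fin B] property_star_iff[OF p fin] star
      block_subset[OF B] by blast
qed

end

section \<open>Regular actions\<close>

lemma (in group) regular_action:
  "transitive_action G (carrier G) (\<lambda>g. \<lambda>x\<in>carrier G. g \<otimes> x)"
proof -
  have bij: "(\<lambda>x\<in>carrier G. g \<otimes> x) \<in> Bij (carrier G)" if g: "g \<in> carrier G" for g
  proof -
    have "bij_betw (\<lambda>x. g \<otimes> x) (carrier G) (carrier G)"
      by (rule bij_betw_byWitness[where f' = "\<lambda>x. inv g \<otimes> x"])
        (use g in \<open>auto simp flip: m_assoc\<close>)
    then show ?thesis by (auto simp: Bij_def cong: bij_betw_cong)
  qed
  have "(\<lambda>g. \<lambda>x\<in>carrier G. g \<otimes> x) \<in> hom G (BijGroup (carrier G))"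
    by (rule homI) (use bij in \<open>auto simp: BijGroup_def compose_def m_assoc intro!: restrict_ext\<close>)
  moreover have "\<exists>g\<in>carrier G. (\<lambda>x\<in>carrier G. g \<otimes> x) x = y"
    if "x \<in> carrier G" "y \<in> carrier G" for x y
    using that by (intro bexI[of _ "y \<otimes> inv x"]) (auto simp: m_assoc)
  ultimately show ?thesis
    by (simp add: transitive_action_def transitive_action_axioms_def group_action_def group_hom_def
      group_hom_axioms_def group_BijGroup is_group)
qed

lemma (in group) property_star_regular:
  assumes "Factorial_Ring.prime p" "finite (carrier G)"
  shows "property_star p G (carrier G) (\<lambda>g. \<lambda>x\<in>carrier G. g \<otimes> x)"
proof -
  obtain P where P: "sylow_subgroup p G P" using exists_sylow_subgroup[OF assms] by blast
  have "stabilizer G (\<lambda>g. \<lambda>x\<in>carrier G. g \<otimes> x) x = {\<one>}" if "x \<in> carrier G" for x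
    using that by (auto simp: stabilizer_def)
  moreover have "P \<inter> {\<one>} = {\<one>}"
    using subgroup.one_closed[OF sylow_subgroupD(1)[OF P]] by blast
  moreover have "sylow_subgroup p (G\<lparr>carrier := {\<one>}\<rparr>) {\<one>}"
    using subgroup_incl[OF triv_subgroup triv_subgroup] by (simp add: sylow_subgroup_def)
  ultimately show ?thesis
    using P unfolding property_star_def by (intro exI[of _ P]) simp
qed

section \<open>A counterexample for the action on the blocks\<close>

text \<open>
  The semidirect product of \<open>\<int>/3\<close> by \<open>\<int>/2\<close> acting by inversion, with the pair of \<open>m mod 3\<close>
  and \<open>m mod 2\<close> encoded as \<open>m < 6\<close>; note that \<open>5 = -1\<close> modulo 6.
\<close>
definition s3 :: "nat monoid" where
  "s3 = \<lparr>carrier = {..<6}, monoid.mult = \<lambda>m n. (if even m then m + n else m + 5 * n) mod 6, one = 0\<rparr>"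

lemma s3_simps:
  "carrier s3 = {..<6}"
  "m \<otimes>\<^bsub>s3\<^esub> n = (if even m then m + n else m + 5 * n) mod 6"
  "\<one>\<^bsub>s3\<^esub> = 0"
  by (simp_all add: s3_def)

lemma carrier_s3_eq: "carrier s3 = {0, 1, 2, 3, 4, 5}"
  by (simp add: s3_simps lessThan_nat_numeral lessThan_Suc insert_commute)

lemma group_s3: "group s3"
proof (rule groupI)
  fix x y z :: nat
  \<comment> \<open>Reduction modulo the even number 6 keeps parity, so the case distinction in the
    product survives nesting.\<close>
  have parity: "even (a mod 6) \<longleftrightarrow> even a" for a :: nat
    by (rule dvd_mod_iff) simp
  have mod_5: "(x + 5 * (a mod 6)) mod 6 = (x + 5 * a) mod 6" for a :: nat
    by (metis mod_add_right_eq mod_mult_right_eq)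
  \<comment> \<open>Associativity for odd \<open>x\<close> and \<open>y\<close> needs that inverting
    twice is the identity: 25 is 1 modulo 6.\<close>
  have "x + (y * 5 + z * 25) = x + (y * 5 + z) + 6 * (4 * z)" by simp
  then have "(x + (y * 5 + z)) mod 6 = (x + (y * 5 + z * 25)) mod 6"
    by (metis mod_mult_self2)
  then show "x \<otimes>\<^bsub>s3\<^esub> y \<otimes>\<^bsub>s3\<^esub> z = x \<otimes>\<^bsub>s3\<^esub> (y \<otimes>\<^bsub>s3\<^esub> z)"
    by (cases "even x"; cases "even y") (simp_all add: s3_simps parity mod_5 mod_simps algebra_simps)
next
  show "\<exists>y\<in>carrier s3. y \<otimes>\<^bsub>s3\<^esub> x = \<one>\<^bsub>s3\<^esub>" if "x \<in> carrier s3" for x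
    using that by (auto simp: carrier_s3_eq s3_simps(2,3))
qed (simp_all add: s3_simps)

abbreviation s3_regular :: "nat \<Rightarrow> nat \<Rightarrow> nat" where
  "s3_regular \<equiv> \<lambda>g. \<lambda>x\<in>carrier s3. g \<otimes>\<^bsub>s3\<^esub> x"

text \<open>These are the left cosets of the non-normal subgroup \<open>{0, 3}\<close>. Left
  multiplication permutes them as the symmetric group permutes three points.\<close>

definition s3_blocks :: "nat set set" where
  "s3_blocks = {{0, 3}, {1, 4}, {2, 5}}"

lemma s3_regular_image_block:
  assumes "C \<in> s3_blocks"
  shows "s3_regular g ` C = (\<lambda>x. (if even g then g + x else g + 5 * x) mod 6) ` C"
  using assms by (intro image_cong) (auto simp: s3_blocks_def s3_simps)

lemma s3_imprimitive: "imprimitive_action s3 (carrier s3) s3_regular s3_blocks"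
proof -
  have "partition_on (carrier s3) s3_blocks"
    by (auto simp: partition_on_def disjoint_def s3_blocks_def carrier_s3_eq)
  moreover have "s3_regular g ` C \<in> s3_blocks" if "g \<in> carrier s3" "C \<in> s3_blocks" for g C
  proof -
    have "\<forall>g\<in>carrier s3. \<forall>C\<in>s3_blocks.
        (\<lambda>x. (if even g then g + x else g + 5 * x) mod 6) ` C \<in> s3_blocks"
      by (simp add: carrier_s3_eq s3_blocks_def insert_commute flip: numeral_2_eq_2)
    with that show ?thesis by (simp only: s3_regular_image_block)
  qed
  ultimately show ?thesis
    using group.regular_action[OF group_s3]
    by (simp add: imprimitive_action_def imprimitive_action_axioms_def system_of_imprimitivity_def)
qed

lemma multiplicity_2_6: "multiplicity 2 (6::nat) = 1"
  by (rule multiplicity_eqI) auto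

text \<open>The Sylow subgroup \<open>{0, 3}\<close> has an orbit of length 2 on the three blocks.\<close>

lemma s3_blocks_not_star:
  "\<not> property_star 2 (induced_on_blocks s3 s3_regular s3_blocks) s3_blocks (\<lambda>f. f)"
proof
  assume star: "property_star 2 (induced_on_blocks s3 s3_regular s3_blocks) s3_blocks (\<lambda>f. f)"
  interpret imprimitive_action s3 "carrier s3" s3_regular s3_blocks by (rule s3_imprimitive)
  interpret blocks: group_action s3 s3_blocks block_action by (rule block_group_action)
  have p: "Factorial_Ring.prime (2::nat)" by (rule two_is_prime_nat)
  have fin: "finite (carrier s3)" by (simp add: s3_simps)
  have "subgroup {0, 3} s3"
  proof (rule G.subgroupI)
    fix a assume a: "a \<in> {0, 3::nat}"
    then have "inv\<^bsub>s3\<^esub> a = a"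
      by (intro G.inv_equality) (auto simp: s3_simps)
    with a show "inv\<^bsub>s3\<^esub> a \<in> {0, 3}" by simp
  qed (auto simp: s3_simps)
  moreover have "order s3 = 6" by (simp add: order_def s3_simps)
  ultimately have P: "sylow_subgroup 2 s3 {0, 3}"
    by (simp add: sylow_subgroup_def multiplicity_2_6)
  \<comment> \<open>The block \<open>{0, 3}\<close> is fixed by the Sylow subgroup
    \<open>{0, 3}\<close>, whereas \<open>{1, 4}\<close> is moved to \<open>{2, 5}\<close>.\<close>
  have B: "{1, 4} \<in> s3_blocks" by (simp add: s3_blocks_def)
  have "property_star 2 s3 s3_blocks block_action"
    using star blocks.property_star_image_iff[OF p fin] by (simp add: induced_on_blocks_eq)
  then have card: "card (orbit (s3\<lparr>carrier := {0, 3}\<rparr>) block_action {1, 4}) =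
      2 ^ multiplicity 2 (card (orbit s3 block_action {1, 4}))"
    using blocks.property_star_iff[OF p fin P] blocks.sylow_stabilizer_iff_card_orbit[OF p fin P B] B
    by blast
  \<comment> \<open>A general \<open>K\<close> covers both the Sylow subgroup and the whole
    group.\<close>
  have image: "orbit K block_action {1, 4} =
      (\<lambda>g. (\<lambda>x. (if even g then g + x else g + 5 * x) mod 6) ` {1, 4}) ` carrier K" for K :: "nat monoid"
    unfolding s3_regular_image_block[OF B, symmetric]
    using B by (auto simp: orbit_def block_action_def)
  have "orbit (s3\<lparr>carrier := {0, 3}\<rparr>) block_action {1, 4} = {{1, 4}, {2, 5}}"
    unfolding image by (simp add: insert_commute flip: numeral_2_eq_2)
  moreover have "orbit s3 block_action {1, 4} = {{0, 3}, {1, 4}, {2, 5}}"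
    unfolding image by (simp add: carrier_s3_eq insert_commute flip: numeral_2_eq_2)
  \<comment> \<open>The \<open>G\<close>-orbit has length 3, whose 2-part is 1, while the orbit of
    the Sylow subgroup has length 2.\<close>
  ultimately show False
    using card by (simp add: doubleton_eq_iff not_dvd_imp_multiplicity_0)
qed

theorem theorem1p2:
  shows "(\<forall>(p::nat) (G::('a, 'c) monoid_scheme) (\<Omega>::'b set) \<phi> \<B> B.
      Factorial_Ring.prime p \<and> finite (carrier G) \<and> finite \<Omega> \<and> transitive_action G \<Omega> \<phi> \<and>
      system_of_imprimitivity G \<Omega> \<phi> \<B> \<and> B \<in> \<B> \<longrightarrow>
        (property_star p (induced_on_block G \<phi> B) B (\<lambda>f. f) \<and>
         property_star p (induced_on_blocks G \<phi> \<B>) \<B> (\<lambda>f. f) \<longrightarrow>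
           property_star p G \<Omega> \<phi>) \<and>
        (property_star p G \<Omega> \<phi> \<longrightarrow>
           property_star p (induced_on_block G \<phi> B) B (\<lambda>f. f))) \<and>
    (\<exists>(p::nat) (G::nat monoid) (\<Omega>::nat set) \<phi> \<B>.
      Factorial_Ring.prime p \<and> finite (carrier G) \<and> finite \<Omega> \<and> transitive_action G \<Omega> \<phi> \<and>
      system_of_imprimitivity G \<Omega> \<phi> \<B> \<and>
      property_star p G \<Omega> \<phi> \<and>
      \<not> property_star p (induced_on_blocks G \<phi> \<B>) \<B> (\<lambda>f. f))"
proof (intro conjI allI impI; (elim conjE)?)
  fix p :: nat and G :: "('a, 'c) monoid_scheme" and \<Omega> :: "'b set" and \<phi> \<B> B
  assume *: "Factorial_Ring.prime p" "finite (carrier G)" "B \<in> \<B>"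
    and "transitive_action G \<Omega> \<phi>" "system_of_imprimitivity G \<Omega> \<phi> \<B>"
  then interpret imprimitive_action G \<Omega> \<phi> \<B>
    by (simp add: imprimitive_action_def imprimitive_action_axioms_def)
  show "property_star p G \<Omega> \<phi>"
    if "property_star p (induced_on_block G \<phi> B) B (\<lambda>f. f)"
      "property_star p (induced_on_blocks G \<phi> \<B>) \<B> (\<lambda>f. f)"
    using property_star_if_blocks[OF * that] .
  show "property_star p (induced_on_block G \<phi> B) B (\<lambda>f. f)" if "property_star p G \<Omega> \<phi>"
    using property_star_induced_on_block[OF * that] .
next
  have fin: "finite (carrier s3)" by (simp add: s3_simps)
  show "\<exists>(p::nat) (G::nat monoid) (\<Omega>::nat set) \<phi> \<B>.
      Factorial_Ring.prime p \<and> finite (carrier G) \<and> finite \<Omega> \<and> transitive_action G \<Omega> \<phi> \<and>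
      system_of_imprimitivity G \<Omega> \<phi> \<B> \<and>
      property_star p G \<Omega> \<phi> \<and>
      \<not> property_star p (induced_on_blocks G \<phi> \<B>) \<B> (\<lambda>f. f)"
    \<comment> \<open>The witness for (3) is the regular action of the symmetric group of degree
      three at the prime 2.\<close>
    using fin s3_imprimitive s3_blocks_not_star
      group.property_star_regular[OF group_s3 two_is_prime_nat fin]
    by (intro exI[of _ 2] exI[of _ s3] exI[of _ "carrier s3"] exI[of _ s3_regular] exI[of _ s3_blocks])
      (auto simp: imprimitive_action_def imprimitive_action_axioms_def)
qed

end
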